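(* Boundedness of $D$ does not imply boundedness of $|D|$, even for a bilinear map involving a single coordinate: there exists a bounded bilinear map $D:\ell^2\times\ell^2\to\ell^2$, with values in the span of the first standard basis vector $\mathrm{e}_1$, such that the associated bilinear map $|D|$ is not bounded on $\ell^2$.
   Context: $\ell^2$ is the real Hilbert space of square-summable sequences with standard orthonormal basis $\{\mathrm{e}_n\}_{n\ge1}$. A bounded bilinear map $D:\ell^2\times\ell^2\to\ell^2$ has kernel $\mathcal{D}(n,k,m)=\langle D(\mathrm{e}_k,\mathrm{e}_m),\mathrm{e}_n\rangle$, so that $D_n(u,v)=\sum_{k,m}\mathcal{D}(n,k,m)u_kv_m$; $|D|$ is the bilinear map with kernel $|\mathcal{D}(n,k,m)|$, defined at least on finitely supported sequences. Not bounded means that there is no constant $C$ with $\||D|(u,v)\|_{\ell^2}\le C\|u\|_{\ell^2}\|v\|_{\ell^2}$ for all finitely supported $u,v$. *)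

theory Defs
  imports "HOL-Analysis.Analysis"
begin

section \<open>The real Hilbert space of square-summable sequences\<close>

text \<open>Coordinates are indexed by \<open>nat\<close> starting from 0, so \<open>ell2_basis n\<close> is the
  \<open>(n+1)\<close>-st standard basis vector.\<close>

typedef ell2 = "{x :: nat \<Rightarrow> real. summable (\<lambda>n. (x n)\<^sup>2)}"
  morphisms coord Abs_ell2
  by (rule exI[of _ "\<lambda>_. 0"]) simp

setup_lifting type_definition_ell2

lemma summable_coord_sq: "summable (\<lambda>n. (coord x n)\<^sup>2)"
  using coord by simp

lemma summable_sq_mult:
  fixes x y :: "nat \<Rightarrow> real"
  assumes "summable (\<lambda>n. (x n)\<^sup>2)" "summable (\<lambda>n. (y n)\<^sup>2)"
  shows "summable (\<lambda>n. x n * y n)"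
proof (rule summable_comparison_test)
  have "\<bar>x n * y n\<bar> \<le> (x n)\<^sup>2 + (y n)\<^sup>2" for n
    using sum_squares_bound[of "\<bar>x n\<bar>" "\<bar>y n\<bar>"]
      mult_nonneg_nonneg[of "\<bar>x n\<bar>" "\<bar>y n\<bar>"]
    unfolding abs_mult power2_abs by linarith
  then show "\<exists>N. \<forall>n\<ge>N. norm (x n * y n) \<le> (x n)\<^sup>2 + (y n)\<^sup>2" by auto
  show "summable (\<lambda>n. (x n)\<^sup>2 + (y n)\<^sup>2)" using assms by (rule summable_add)
qed

lemma summable_sq_add:
  fixes x y :: "nat \<Rightarrow> real"
  assumes "summable (\<lambda>n. (x n)\<^sup>2)" "summable (\<lambda>n. (y n)\<^sup>2)"
  shows "summable (\<lambda>n. (x n + y n)\<^sup>2)"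
proof -
  have "summable (\<lambda>n. (x n)\<^sup>2 + (y n)\<^sup>2 + 2 * (x n * y n))"
    using assms by (intro summable_add summable_mult summable_sq_mult)
  then show ?thesis by (simp add: power2_sum mult.assoc)
qed

lemma summable_sq_scale:
  fixes x :: "nat \<Rightarrow> real"
  assumes "summable (\<lambda>n. (x n)\<^sup>2)"
  shows "summable (\<lambda>n. (c * x n)\<^sup>2)"
  unfolding power_mult_distrib using assms by (rule summable_mult)

instantiation ell2 :: real_vector
begin

lift_definition zero_ell2 :: ell2 is "\<lambda>_. 0" by simp
lift_definition plus_ell2 :: "ell2 \<Rightarrow> ell2 \<Rightarrow> ell2" is "\<lambda>x y n. x n + y n"
  by (rule summable_sq_add)
lift_definition uminus_ell2 :: "ell2 \<Rightarrow> ell2" is "\<lambda>x n. - x n" by simp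
lift_definition minus_ell2 :: "ell2 \<Rightarrow> ell2 \<Rightarrow> ell2" is "\<lambda>x y n. x n - y n"
  subgoal for x y using summable_sq_add[of x "\<lambda>n. - y n"] by simp
  done
lift_definition scaleR_ell2 :: "real \<Rightarrow> ell2 \<Rightarrow> ell2" is "\<lambda>c x n. c * x n"
  by (rule summable_sq_scale)

instance
  by standard (transfer, simp add: algebra_simps fun_eq_iff)+

end

lemma coord_simps [simp]:
  "coord 0 n = 0"
  "coord (x + y) n = coord x n + coord y n"
  "coord (- x) n = - coord x n"
  "coord (x - y) n = coord x n - coord y n"
  "coord (c *\<^sub>R x) n = c * coord x n"
  by (transfer, simp)+

lemma summable_coord_mult: "summable (\<lambda>n. coord x n * coord y n)"
  by (intro summable_sq_mult summable_coord_sq)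

lemma ell2_eqI: "(\<And>n. coord x n = coord y n) \<Longrightarrow> x = y"
  by (metis coord_inject ext)

instantiation ell2 :: real_inner
begin

definition inner_ell2 :: "ell2 \<Rightarrow> ell2 \<Rightarrow> real"
  where "inner_ell2 x y = (\<Sum>n. coord x n * coord y n)"
definition norm_ell2 :: "ell2 \<Rightarrow> real"
  where "norm_ell2 x = sqrt (inner x x)"
definition dist_ell2 :: "ell2 \<Rightarrow> ell2 \<Rightarrow> real"
  where "dist_ell2 x y = norm (x - y)"
definition sgn_ell2 :: "ell2 \<Rightarrow> ell2"
  where "sgn_ell2 x = x /\<^sub>R norm x"
definition uniformity_ell2 :: "(ell2 \<times> ell2) filter"
  where "uniformity_ell2 = (INF e\<in>{0<..}. principal {(x, y). dist x y < e})"
definition open_ell2 :: "ell2 set \<Rightarrow> bool"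
  where "open_ell2 U \<longleftrightarrow> (\<forall>x\<in>U. \<forall>\<^sub>F (x', y) in uniformity. x' = x \<longrightarrow> y \<in> U)"

instance
proof
  fix x y z :: ell2 and r :: real
  show "inner x y = inner y x"
    by (simp add: inner_ell2_def mult.commute)
  show "inner (x + y) z = inner x z + inner y z"
    by (simp add: inner_ell2_def distrib_right suminf_add summable_coord_mult)
  show "inner (r *\<^sub>R x) y = r * inner x y"
    by (simp add: inner_ell2_def mult.assoc suminf_mult summable_coord_mult)
  show "0 \<le> inner x x"
    by (simp add: inner_ell2_def suminf_nonneg summable_coord_mult)
  show "inner x x = 0 \<longleftrightarrow> x = 0"
  proof
    assume "inner x x = 0"
    then have "\<forall>n. coord x n * coord x n = 0"
      unfolding inner_ell2_def
      by (subst (asm) suminf_eq_zero_iff) (auto simp: summable_coord_mult)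
    then show "x = 0" by (intro ell2_eqI) simp
  qed (simp add: inner_ell2_def)
qed (simp_all only: dist_ell2_def norm_ell2_def sgn_ell2_def uniformity_ell2_def open_ell2_def)

end

lemma norm_ell2_sq: "(norm x)\<^sup>2 = (\<Sum>n. (coord x n)\<^sup>2)"
  by (subst power2_norm_eq_inner) (simp add: inner_ell2_def power2_eq_square)

lemma sum_coord_sq_le: "(\<Sum>n<N. (coord x n)\<^sup>2) \<le> (norm x)\<^sup>2"
  unfolding norm_ell2_sq by (rule sum_le_suminf) (auto simp: summable_coord_sq)

lemma abs_coord_le_norm: "\<bar>coord x n\<bar> \<le> norm x"
proof -
  have "(coord x n)\<^sup>2 \<le> (\<Sum>k<Suc n. (coord x k)\<^sup>2)" by (simp add: sum_nonneg)
  also have "\<dots> \<le> (norm x)\<^sup>2" by (rule sum_coord_sq_le)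
  finally show ?thesis by (simp add: abs_le_square_iff[symmetric])
qed

instance ell2 :: complete_space
proof
  fix X :: "nat \<Rightarrow> ell2"
  assume X: "Cauchy X"
  have "Cauchy (\<lambda>i. coord (X i) n)" for n
  proof (rule CauchyI)
    fix e :: real assume "0 < e"
    then obtain M where M: "norm (X i - X j) < e" if "i \<ge> M" "j \<ge> M" for i j
      using CauchyD[OF X] by blast
    have "norm (coord (X i) n - coord (X j) n) < e" if "i \<ge> M" "j \<ge> M" for i j
      using abs_coord_le_norm[of "X i - X j" n] M[OF that] by simp
    then show "\<exists>M. \<forall>i\<ge>M. \<forall>j\<ge>M. norm (coord (X i) n - coord (X j) n) < e" by blast
  qed
  then have "convergent (\<lambda>i. coord (X i) n)" for n
    by (rule real_Cauchy_convergent)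
  then have l0: "(\<lambda>i. coord (X i) n) \<longlonglongrightarrow> lim (\<lambda>i. coord (X i) n)" for n
    by (simp add: convergent_LIMSEQ_iff)
  define l where "l n = lim (\<lambda>i. coord (X i) n)" for n
  have l: "(\<lambda>i. coord (X i) n) \<longlonglongrightarrow> l n" for n
    unfolding l_def by (rule l0)
  have tail: "\<exists>M. \<forall>i\<ge>M. \<forall>N. (\<Sum>n<N. (coord (X i) n - l n)\<^sup>2) \<le> e\<^sup>2" if "0 < e" for e
  proof -
    obtain M where M: "norm (X i - X j) < e" if "i \<ge> M" "j \<ge> M" for i j
      using CauchyD[OF X \<open>0 < e\<close>] by blast
    have "(\<Sum>n<N. (coord (X i) n - l n)\<^sup>2) \<le> e\<^sup>2" if i: "i \<ge> M" for i N
    proof (rule Lim_bounded)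
      show "(\<lambda>j. \<Sum>n<N. (coord (X i) n - coord (X j) n)\<^sup>2)
          \<longlonglongrightarrow> (\<Sum>n<N. (coord (X i) n - l n)\<^sup>2)"
        by (intro tendsto_intros l)
      show "\<forall>j\<ge>M. (\<Sum>n<N. (coord (X i) n - coord (X j) n)\<^sup>2) \<le> e\<^sup>2"
      proof (intro allI impI)
        fix j assume "j \<ge> M"
        have "(\<Sum>n<N. (coord (X i) n - coord (X j) n)\<^sup>2) \<le> (norm (X i - X j))\<^sup>2"
          using sum_coord_sq_le[of "X i - X j" N] by simp
        also have "\<dots> \<le> e\<^sup>2"
          using M[OF i \<open>j \<ge> M\<close>] by (intro power_mono) auto
        finally show "(\<Sum>n<N. (coord (X i) n - coord (X j) n)\<^sup>2) \<le> e\<^sup>2" .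
      qed
    qed
    then show ?thesis by blast
  qed
  obtain M where M: "(\<Sum>n<N. (coord (X M) n - l n)\<^sup>2) \<le> 1\<^sup>2" for N
    using tail[of 1] by auto
  have "summable (\<lambda>n. (coord (X M) n - l n)\<^sup>2)"
    by (rule summableI_nonneg_bounded[where x = "1\<^sup>2"]) (use M in auto)
  then have "summable (\<lambda>n. (coord (X M) n + - 1 * (coord (X M) n - l n))\<^sup>2)"
    by (intro summable_sq_add summable_sq_scale summable_coord_sq)
  then have L: "coord (Abs_ell2 l) = l" by (simp add: Abs_ell2_inverse)
  have "X \<longlonglongrightarrow> Abs_ell2 l"
  proof (rule LIMSEQ_I)
    fix e :: real assume "0 < e"
    then obtain M where M: "(\<Sum>n<N. (coord (X i) n - l n)\<^sup>2) \<le> (e/2)\<^sup>2" if "i \<ge> M" for i N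
      using tail[of "e/2"] by auto
    have "norm (X i - Abs_ell2 l) < e" if "i \<ge> M" for i
    proof -
      have "(norm (X i - Abs_ell2 l))\<^sup>2 \<le> (e/2)\<^sup>2"
        unfolding norm_ell2_sq using M[OF that] summable_coord_sq[of "X i - Abs_ell2 l"]
        by (intro suminf_le_const) (auto simp: L)
      then have "norm (X i - Abs_ell2 l) \<le> e/2"
        by (rule power2_le_imp_le) (use \<open>0 < e\<close> in simp)
      then show ?thesis using \<open>0 < e\<close> by simp
    qed
    then show "\<exists>M. \<forall>i\<ge>M. norm (X i - Abs_ell2 l) < e" by blast
  qed
  then show "convergent X" by (auto simp: convergent_def)
qed

lift_definition ell2_basis :: "nat \<Rightarrow> ell2" is "\<lambda>n k. if k = n then 1 else 0"
  subgoal for n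
    by (rule summable_finite[of "{n}"]) auto
  done

lemma inner_ell2_basis [simp]: "inner x (ell2_basis n) = coord x n"
proof -
  have "(\<lambda>k. coord x k * coord (ell2_basis n) k) sums (\<Sum>k\<in>{n}. coord x k * coord (ell2_basis n) k)"
    by (rule sums_finite) (auto simp: ell2_basis.rep_eq)
  then show ?thesis by (simp add: inner_ell2_def sums_iff ell2_basis.rep_eq)
qed

section \<open>Kernels of bilinear maps and the map with absolute kernel\<close>

definition bilinear_kernel :: "(ell2 \<Rightarrow> ell2 \<Rightarrow> ell2) \<Rightarrow> nat \<Rightarrow> nat \<Rightarrow> nat \<Rightarrow> real"
  where "bilinear_kernel D n k m = inner (D (ell2_basis k) (ell2_basis m)) (ell2_basis n)"

definition supp :: "ell2 \<Rightarrow> nat set"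
  where "supp u = {k. coord u k \<noteq> 0}"

text \<open>The map \<open>|D|\<close>.  It is meaningful for \<open>u\<close> and \<open>v\<close> of finite support only; there the
  sums are finite and the resulting sequence is square-summable for every \<open>D\<close>
  (lemma \<open>coord_abs_bilinear\<close> below).\<close>

definition abs_bilinear :: "(ell2 \<Rightarrow> ell2 \<Rightarrow> ell2) \<Rightarrow> ell2 \<Rightarrow> ell2 \<Rightarrow> ell2"
  where "abs_bilinear D u v =
    Abs_ell2 (\<lambda>n. \<Sum>k\<in>supp u. \<Sum>m\<in>supp v. \<bar>bilinear_kernel D n k m\<bar> * coord u k * coord v m)"

definition bounded_on_finite_supp :: "(ell2 \<Rightarrow> ell2 \<Rightarrow> ell2) \<Rightarrow> bool"
  where "bounded_on_finite_supp B \<longleftrightarrow>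
    (\<exists>C. \<forall>u v. finite (supp u) \<longrightarrow> finite (supp v) \<longrightarrow> norm (B u v) \<le> C * norm u * norm v)"

lemma summable_sq_sum:
  fixes f :: "'a \<Rightarrow> nat \<Rightarrow> real"
  assumes "\<And>a. a \<in> A \<Longrightarrow> summable (\<lambda>n. (f a n)\<^sup>2)"
  shows "summable (\<lambda>n. (\<Sum>a\<in>A. f a n)\<^sup>2)"
  using assms by (induction A rule: infinite_finite_induct) (auto intro!: summable_sq_add)

lemma coord_abs_bilinear:
  "coord (abs_bilinear D u v) n =
    (\<Sum>k\<in>supp u. \<Sum>m\<in>supp v. \<bar>bilinear_kernel D n k m\<bar> * coord u k * coord v m)"
proof -
  have "summable (\<lambda>n. (coord u k * coord v m * \<bar>bilinear_kernel D n k m\<bar>)\<^sup>2)" for k m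
    by (rule summable_sq_scale) (simp add: bilinear_kernel_def summable_coord_sq)
  then have "summable (\<lambda>n. (\<bar>bilinear_kernel D n k m\<bar> * coord u k * coord v m)\<^sup>2)" for k m
    by (simp add: mult_ac)
  then have "summable (\<lambda>n. (\<Sum>k\<in>supp u. \<Sum>m\<in>supp v.
      \<bar>bilinear_kernel D n k m\<bar> * coord u k * coord v m)\<^sup>2)"
    by (intro summable_sq_sum)
  then show ?thesis by (simp add: abs_bilinear_def Abs_ell2_inverse)
qed

end

theory Submission
  imports Defs
begin

text \<open>A map with values in the span of one basis vector is a scalar bilinear form, that is, an
  infinite matrix, so the claim is that a matrix can be bounded on \<open>\<ell>\<^sup>2\<close> by virtue of
  cancellation between its signs.  The standard source of such cancellation is the Sylvester
  (Walsh-Hadamard) sign matrix \<open>H\<^sub>j\<close> of size \<open>2^j\<close>: it is \<open>sqrt 2 ^ j\<close> times an orthogonal matrix,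
  hence has norm \<open>sqrt 2 ^ j\<close> (\<open>abs_sylvester_form_le\<close>), whereas the matrix of its absolute values
  is constantly 1 and has norm \<open>2^j\<close>.

  To combine all sizes in one operator, observe that \<open>H\<^sub>j\<close> is the upper left corner of
  \<open>H\<^sub>i\<close> for \<open>i \<ge> j\<close>.  The weighted sum of the \<open>H\<^sub>j\<close>, each extended by zero, therefore has no
  cancellation inside any single entry, and its absolute value is the sum of the absolute values.
  With the weights \<open>(2/3)^j\<close> the sum converges in norm, because \<open>2/3 * sqrt 2 < 1\<close>
  (\<open>bounded_bilinear_walsh_form\<close>), while the absolute value dominates a matrix of norm
  \<open>(2/3)^j * 2^j = (4/3)^j\<close> for every \<open>j\<close> (\<open>abs_walsh_form_basis_ge\<close>).\<close>

section \<open>Sylvester sign matrices\<close>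

text \<open>The value is \<open>(-1)^d\<close>, where \<open>d\<close> is the number of binary places at which both \<open>k\<close> and \<open>m\<close>
  have the digit 1.\<close>

fun sylvester_sign :: "nat \<Rightarrow> nat \<Rightarrow> real" where
  "sylvester_sign k m = (if k = 0 \<or> m = 0 then 1
     else sylvester_sign (k div 2) (m div 2) * (if odd k \<and> odd m then -1 else 1))"

declare sylvester_sign.simps [simp del]

lemma abs_sylvester_sign [simp]: "\<bar>sylvester_sign k m\<bar> = 1"
proof (induction k m rule: sylvester_sign.induct)
  case (1 k m)
  then show ?case by (subst sylvester_sign.simps) (auto simp: abs_mult)
qed

lemma sylvester_sign_zero [simp]: "sylvester_sign 0 m = 1" "sylvester_sign k 0 = 1"
  by (subst sylvester_sign.simps, simp)+

lemma sylvester_sign_double: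
  "sylvester_sign (2 * k) (2 * m) = sylvester_sign k m"
  "sylvester_sign (2 * k) (Suc (2 * m)) = sylvester_sign k m"
  "sylvester_sign (Suc (2 * k)) (2 * m) = sylvester_sign k m"
  "sylvester_sign (Suc (2 * k)) (Suc (2 * m)) = - sylvester_sign k m"
  by (subst sylvester_sign.simps, simp)+

definition sylvester_form :: "nat \<Rightarrow> (nat \<Rightarrow> real) \<Rightarrow> (nat \<Rightarrow> real) \<Rightarrow> real" where
  "sylvester_form j x y = (\<Sum>k<2^j. \<Sum>m<2^j. sylvester_sign k m * x k * y m)"

lemma sum_lessThan_double:
  fixes f :: "nat \<Rightarrow> 'a::comm_monoid_add"
  shows "(\<Sum>k<2*n. f k) = (\<Sum>k<n. f (2*k) + f (Suc (2*k)))"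
  by (induction n) (simp_all add: add.assoc)

text \<open>This is the block structure of \<open>H\<^bsub>j+1\<^esub>\<close> in terms of \<open>H\<^sub>j\<close>; since digits are split off at the
  low end, the two halves of a vector are its even and its odd part.\<close>

lemma sylvester_form_Suc:
  "sylvester_form (Suc j) x y =
     sylvester_form j (\<lambda>k. x (2*k)) (\<lambda>m. y (2*m) + y (Suc (2*m))) +
     sylvester_form j (\<lambda>k. x (Suc (2*k))) (\<lambda>m. y (2*m) - y (Suc (2*m)))"
  by (simp add: sylvester_form_def sum_lessThan_double sylvester_sign_double
      flip: sum.distrib) (simp add: algebra_simps)

text \<open>In the induction step the Cauchy-Schwarz inequality in the plane combines the bounds for the two
  halves, and the new factor 2 comes from the parallelogram law: passing from a vector to the sum
  and the difference of its two halves doubles the sum of squares.\<close>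

lemma sylvester_form_sq_le:
  "(sylvester_form j x y)\<^sup>2 \<le> 2^j * (\<Sum>k<2^j. (x k)\<^sup>2) * (\<Sum>m<2^j. (y m)\<^sup>2)"
proof (induction j arbitrary: x y)
  case 0
  then show ?case by (simp add: sylvester_form_def power_mult_distrib)
next
  case (Suc j)
  define a where "a = sylvester_form j (\<lambda>k. x (2*k)) (\<lambda>m. y (2*m) + y (Suc (2*m)))"
  define b where "b = sylvester_form j (\<lambda>k. x (Suc (2*k))) (\<lambda>m. y (2*m) - y (Suc (2*m)))"
  define p where "p = (\<Sum>k<2^j. (x (2*k))\<^sup>2)"
  define q where "q = (\<Sum>k<2^j. (x (Suc (2*k)))\<^sup>2)"
  define r where "r = (\<Sum>m<2^j. (y (2*m) + y (Suc (2*m)))\<^sup>2)"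
  define s where "s = (\<Sum>m<2^j. (y (2*m) - y (Suc (2*m)))\<^sup>2)"
  define c where "c = (2::real)^j"
  have nonneg: "0 \<le> p" "0 \<le> q" "0 \<le> r" "0 \<le> s" "0 < c"
    by (simp_all add: p_def q_def r_def s_def c_def sum_nonneg)
  have a: "a\<^sup>2 \<le> c * p * r"
    using Suc.IH by (simp add: a_def p_def r_def c_def)
  have b: "b\<^sup>2 \<le> c * q * s"
    using Suc.IH by (simp add: b_def q_def s_def c_def)
  have "\<bar>a\<bar> \<le> sqrt c * (sqrt p * sqrt r)"
    using real_sqrt_le_mono[OF a] by (simp add: real_sqrt_mult mult.assoc)
  moreover have "\<bar>b\<bar> \<le> sqrt c * (sqrt q * sqrt s)"
    using real_sqrt_le_mono[OF b] by (simp add: real_sqrt_mult mult.assoc)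
  ultimately have "\<bar>a + b\<bar> \<le> sqrt c * (sqrt p * sqrt r + sqrt q * sqrt s)"
    by (simp add: distrib_left)
  then have "(a + b)\<^sup>2 \<le> (sqrt c * (sqrt p * sqrt r + sqrt q * sqrt s))\<^sup>2"
    by (simp add: abs_le_square_iff[symmetric] nonneg)
  also have "\<dots> = c * (sqrt p * sqrt r + sqrt q * sqrt s)\<^sup>2"
    using nonneg by (simp add: power_mult_distrib)
  also have "(sqrt p * sqrt r + sqrt q * sqrt s)\<^sup>2 \<le> (p + q) * (r + s)"
  proof -
    have "(p + q) * (r + s) =
        (sqrt p * sqrt r + sqrt q * sqrt s)\<^sup>2 + (sqrt p * sqrt s - sqrt q * sqrt r)\<^sup>2"
    proof -
      have "(P\<^sup>2 + Q\<^sup>2) * (R\<^sup>2 + S\<^sup>2) = (P * R + Q * S)\<^sup>2 + (P * S - Q * R)\<^sup>2"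
        for P Q R S :: real
        by (simp add: power2_eq_square algebra_simps)
      from this[of "sqrt p" "sqrt q" "sqrt r" "sqrt s"] show ?thesis
        using nonneg by simp
    qed
    then show ?thesis by simp
  qed
  also have "c * ((p + q) * (r + s)) =
      2 ^ Suc j * (\<Sum>k<2^Suc j. (x k)\<^sup>2) * (\<Sum>m<2^Suc j. (y m)\<^sup>2)"
  proof -
    have "r + s = 2 * (\<Sum>m<2^Suc j. (y m)\<^sup>2)"
      by (simp add: r_def s_def sum_lessThan_double sum_distrib_left power2_eq_square
          algebra_simps flip: sum.distrib)
    moreover have "p + q = (\<Sum>k<2^Suc j. (x k)\<^sup>2)"
      by (simp add: p_def q_def sum_lessThan_double sum.distrib)
    ultimately show ?thesis by (simp add: c_def)
  qed
  finally show ?case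
    using nonneg by (simp add: sylvester_form_Suc a_def b_def mult_left_mono)
qed

lemma abs_sylvester_form_le:
  "\<bar>sylvester_form j (coord u) (coord v)\<bar> \<le> sqrt 2 ^ j * norm u * norm v"
proof -
  have "(sylvester_form j (coord u) (coord v))\<^sup>2
      \<le> 2^j * (\<Sum>k<2^j. (coord u k)\<^sup>2) * (\<Sum>m<2^j. (coord v m)\<^sup>2)"
    by (rule sylvester_form_sq_le)
  also have "\<dots> \<le> 2^j * (norm u)\<^sup>2 * (norm v)\<^sup>2"
    by (intro mult_mono sum_coord_sq_le) (auto simp: sum_nonneg)
  also have "\<dots> = (sqrt 2 ^ j * norm u * norm v)\<^sup>2"
  proof -
    have "(sqrt 2 ^ j)\<^sup>2 = (2::real)^j"
      by (metis power_mult mult.commute real_sqrt_pow2 zero_le_numeral)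
    then show ?thesis by (simp add: power_mult_distrib)
  qed
  finally show ?thesis by (simp add: abs_le_square_iff[symmetric])
qed

lemma sylvester_form_basis:
  "sylvester_form j (coord (ell2_basis k)) (coord (ell2_basis m)) =
     (if k < 2^j \<and> m < 2^j then sylvester_sign k m else 0)"
  by (cases "m < 2^j")
    (simp_all add: sylvester_form_def ell2_basis.rep_eq mult_delta_right mult_delta_left)

section \<open>The weighted sum of all corners\<close>

definition walsh_form :: "ell2 \<Rightarrow> ell2 \<Rightarrow> real" where
  "walsh_form u v = (\<Sum>j. (2/3)^j * sylvester_form j (coord u) (coord v))"

lemma summable_walsh_bound: "summable (\<lambda>j. (2/3 * sqrt 2)^j)"
proof (rule summable_geometric)
  have "sqrt 2 < 3/2" by (rule real_less_lsqrt) (auto simp: power2_eq_square)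
  then show "norm (2/3 * sqrt 2) < 1" by simp
qed

lemma walsh_term_le:
  "norm ((2/3)^j * sylvester_form j (coord u) (coord v))
     \<le> (2/3 * sqrt 2)^j * (norm u * norm v)"
proof -
  have "norm ((2/3)^j * sylvester_form j (coord u) (coord v))
      \<le> (2/3)^j * (sqrt 2 ^ j * norm u * norm v)"
    using mult_left_mono[OF abs_sylvester_form_le[of j u v], of "(2/3)^j"]
    by (simp add: abs_mult)
  then show ?thesis by (simp only: power_mult_distrib mult.assoc)
qed

lemma summable_walsh: "summable (\<lambda>j. (2/3)^j * sylvester_form j (coord u) (coord v))"
  by (rule summable_comparison_test'[OF summable_mult2[OF summable_walsh_bound]])
    (rule walsh_term_le)

lemma bounded_bilinear_walsh_form: "bounded_bilinear walsh_form"
proof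
  fix u u' v v' :: ell2 and c :: real
  show "walsh_form (u + u') v = walsh_form u v + walsh_form u' v"
    unfolding walsh_form_def suminf_add[OF summable_walsh summable_walsh]
    by (simp add: sylvester_form_def algebra_simps sum.distrib)
  show "walsh_form u (v + v') = walsh_form u v + walsh_form u v'"
    unfolding walsh_form_def suminf_add[OF summable_walsh summable_walsh]
    by (simp add: sylvester_form_def algebra_simps sum.distrib)
  show "walsh_form (c *\<^sub>R u) v = c *\<^sub>R walsh_form u v"
    unfolding walsh_form_def real_scaleR_def suminf_mult[OF summable_walsh, symmetric]
    by (simp add: sylvester_form_def sum_distrib_left mult_ac)
  show "walsh_form u (c *\<^sub>R v) = c *\<^sub>R walsh_form u v"
    unfolding walsh_form_def real_scaleR_def suminf_mult[OF summable_walsh, symmetric]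
    by (simp add: sylvester_form_def sum_distrib_left mult_ac)
next
  have "norm (walsh_form u v) \<le> (\<Sum>j. (2/3 * sqrt 2)^j * (norm u * norm v))" for u v
    unfolding walsh_form_def
    by (rule norm_suminf_le[OF walsh_term_le summable_mult2[OF summable_walsh_bound]])
  then show "\<exists>K. \<forall>u v. norm (walsh_form u v) \<le> norm u * norm v * K"
    unfolding suminf_mult2[OF summable_walsh_bound, symmetric]
      mult.commute[of "\<Sum>j. (2/3 * sqrt 2)^j"]
    by blast
qed

text \<open>Every corner that contains the entry \<open>(k, m)\<close> contributes to it with the same sign, so a
  single summand is a lower bound for the absolute value of the sum.\<close>

lemma abs_walsh_form_basis_ge:
  assumes "k < 2^j" "m < 2^j"
  shows "(2/3)^j \<le> \<bar>walsh_form (ell2_basis k) (ell2_basis m)\<bar>"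
proof -
  define w :: "nat \<Rightarrow> real" where "w i = (if k < 2^i \<and> m < 2^i then (2/3)^i else 0)" for i
  have w: "summable w"
    by (rule summable_comparison_test'[OF summable_geometric[of "2/3"]]) (auto simp: w_def)
  have "walsh_form (ell2_basis k) (ell2_basis m) = (\<Sum>i. sylvester_sign k m * w i)"
    unfolding walsh_form_def sylvester_form_basis w_def by (intro suminf_cong) auto
  also have "\<dots> = sylvester_sign k m * suminf w"
    by (rule suminf_mult[OF w])
  finally have "\<bar>walsh_form (ell2_basis k) (ell2_basis m)\<bar> = \<bar>suminf w\<bar>"
    by (simp add: abs_mult)
  moreover have "sum w {j} \<le> suminf w"
    by (rule sum_le_suminf[OF w]) (auto simp: w_def)
  ultimately show ?thesis using assms by (simp add: w_def)
qed

lemma bounded_bilinear_scaleR_const: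
  fixes f :: "'a::real_normed_vector \<Rightarrow> 'b::real_normed_vector \<Rightarrow> real"
    and e :: "'c::real_normed_vector"
  assumes "bounded_bilinear f"
  shows "bounded_bilinear (\<lambda>u v. f u v *\<^sub>R e)"
proof -
  interpret bounded_bilinear f by fact
  show ?thesis
  proof
    obtain K where K: "norm (f u v) \<le> norm u * norm v * K" for u v
      using bounded by blast
    have "norm (f u v *\<^sub>R e) \<le> norm u * norm v * (K * norm e)" for u v
      using mult_right_mono[OF K[of u v], of "norm e"] by (simp add: mult.assoc)
    then show "\<exists>K. \<forall>u v. norm (f u v *\<^sub>R e) \<le> norm u * norm v * K"
      by blast
  qed (simp_all add: add_left add_right scaleR_left scaleR_right scaleR_add_left)
qed

section \<open>Unboundedness of the absolute value\<close>

lift_definition ones :: "nat \<Rightarrow> ell2" is "\<lambda>N k. if k < N then 1 else 0"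
  subgoal for N
    by (rule summable_finite[of "{..<N}"]) auto
  done

lemma supp_ones: "supp (ones N) = {..<N}"
  by (auto simp: supp_def ones.rep_eq)

lemma norm_ones_sq: "norm (ones N) * norm (ones N) = real N"
proof -
  have "(\<Sum>n. (coord (ones N) n)\<^sup>2) = (\<Sum>n<N. (coord (ones N) n)\<^sup>2)"
    by (rule suminf_finite) (auto simp: ones.rep_eq)
  then have "(norm (ones N))\<^sup>2 = real N"
    by (simp add: norm_ell2_sq ones.rep_eq)
  then show ?thesis by (simp add: power2_eq_square)
qed

theorem mainTheorem6:
  shows "\<exists>D :: ell2 \<Rightarrow> ell2 \<Rightarrow> ell2.
    bounded_bilinear D \<and>
    (\<forall>u v. D u v \<in> span {ell2_basis 0}) \<and>
    \<not> bounded_on_finite_supp (abs_bilinear D)"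
proof (intro exI conjI allI)
  define D where "D u v = walsh_form u v *\<^sub>R ell2_basis 0" for u v
  show "bounded_bilinear D"
    unfolding D_def by (rule bounded_bilinear_scaleR_const[OF bounded_bilinear_walsh_form])
  show "D u v \<in> span {ell2_basis 0}" for u v
    unfolding D_def by (intro span_scale span_base) simp
  have kernel: "bilinear_kernel D 0 k m = walsh_form (ell2_basis k) (ell2_basis m)" for k m
    by (simp add: bilinear_kernel_def D_def ell2_basis.rep_eq)
  show "\<not> bounded_on_finite_supp (abs_bilinear D)"
  proof
    assume "bounded_on_finite_supp (abs_bilinear D)"
    then obtain C where
      C: "norm (abs_bilinear D u v) \<le> C * norm u * norm v"
      if "finite (supp u)" "finite (supp v)" for u v
      unfolding bounded_on_finite_supp_def by blast
    have "(4/3)^j \<le> C" for j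
    proof -
      let ?u = "ones (2^j)"
      have "2^j * (2^j * (2/3)^j) = (\<Sum>k<(2::nat)^j. \<Sum>m<(2::nat)^j. (2/3::real)^j)"
        by simp
      also have "\<dots> \<le> (\<Sum>k<2^j. \<Sum>m<2^j. \<bar>bilinear_kernel D 0 k m\<bar>)"
        by (intro sum_mono) (simp add: kernel abs_walsh_form_basis_ge)
      also have "\<dots> = coord (abs_bilinear D ?u ?u) 0"
        by (simp add: coord_abs_bilinear supp_ones ones.rep_eq)
      also have "\<dots> \<le> norm (abs_bilinear D ?u ?u)"
        using abs_coord_le_norm[of "abs_bilinear D ?u ?u" 0] by simp
      also have "\<dots> \<le> 2^j * C"
        using C[of ?u ?u] norm_ones_sq[of "2^j"] by (simp add: supp_ones mult_ac)
      finally have "2^j * (2/3)^j \<le> C" by simp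
      then show ?thesis by (simp flip: power_mult_distrib)
    qed
    moreover obtain j where "C < (4/3)^j"
      using real_arch_pow[of "4/3" C] by auto
    ultimately show False by (meson not_le)
  qed
qed

end
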